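(* Let $G_6$ be the graph with vertex set $\{1,\dots,6\}$ and edges $\{1,2\},\{1,3\},\{1,4\},\{1,5\},\{1,6\},\{2,3\},\{2,4\},\{2,5\},\{3,4\},\{5,6\}$. The set of eigenvalues of the $1$-Laplacian of $G_6$ is $$\sigma(G_6)=\Big\{0,\tfrac25,\tfrac59,\tfrac35,\tfrac23,\tfrac57,\tfrac34,\tfrac79,1\Big\}.$$ In particular there is an eigenvalue of the $1$-Laplacian of $G_6$ which does not belong to the set $\{c_1,\dots,c_6\}$ of minimax values.
   Context: For a finite simple connected graph $G=(V,E)$, $V=\{1,\dots,n\}$, with degrees $d_i$: $\mathrm{Sgn}(t)=\{1\}$ if $t>0$, $\{-1\}$ if $t<0$, $[-1,1]$ if $t=0$; $I(\vec x)=\sum_{\{i,j\}\in E}|x_i-x_j|$; $X=\{\vec x\in\mathbb R^n:\sum_i d_i|x_i|=1\}$. A real number $\mu$ is an eigenvalue of the $1$-Laplacian if there is a nonzero $\vec x\in\mathbb R^n$ and numbers $z_{ij}\in\mathrm{Sgn}(x_i-x_j)$ with $z_{ji}=-z_{ij}$ (for all adjacent $i,j$) such that $\sum_{j\sim i}z_{ij}\in\mu d_i\,\mathrm{Sgn}(x_i)$ for all $i\in V$. $c_k=\inf_{\gamma(A)\ge k}\max_{\vec x\in A}I(\vec x)$, $k=1,\dots,n$, the infimum over closed sets $A=-A\subset X$, where $\gamma(A)$ is the Krasnoselskii genus: the least integer $m\ge0$ for which there is an odd continuous map $A\to\mathbb R^m\setminus\{0\}$. *)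

theory Defs
  imports "HOL-Analysis.Analysis"
begin

text \<open>A simple graph has the finite type \<open>'v\<close> as its vertex set and is given by its set of
  edges \<open>{i, j}\<close>; vectors on the vertices are elements of \<open>real ^ 'v\<close>.\<close>

definition simple_graph :: "'v::finite set set \<Rightarrow> bool" where
  "simple_graph E \<longleftrightarrow> (\<forall>e\<in>E. card e = 2)"

definition connected_graph :: "'v::finite set set \<Rightarrow> bool" where
  "connected_graph E \<longleftrightarrow> (\<forall>i j. (i, j) \<in> {(u, v). {u, v} \<in> E}\<^sup>*)"

definition vertex_degree :: "'v::finite set set \<Rightarrow> 'v \<Rightarrow> nat" where
  "vertex_degree E i = card {j. {i, j} \<in> E}"

definition Sgn :: "real \<Rightarrow> real set" where
  "Sgn t = (if t > 0 then {1} else if t < 0 then {-1} else {-1..1})"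

definition one_laplacian_eigenvalue :: "'v::finite set set \<Rightarrow> real \<Rightarrow> bool" where
  "one_laplacian_eigenvalue E \<mu> \<longleftrightarrow>
     (\<exists>x :: real ^ 'v. x \<noteq> 0 \<and>
        (\<exists>z :: 'v \<Rightarrow> 'v \<Rightarrow> real.
           (\<forall>i j. {i, j} \<in> E \<longrightarrow> z i j \<in> Sgn (x $ i - x $ j) \<and> z j i = - z i j) \<and>
           (\<forall>i. (\<Sum>j | {i, j} \<in> E. z i j) \<in> (\<lambda>s. \<mu> * real (vertex_degree E i) * s) ` Sgn (x $ i))))"

text \<open>The sum below runs over ordered pairs, so every edge \<open>{i, j}\<close> occurs twice.\<close>

definition total_variation :: "'v::finite set set \<Rightarrow> real ^ 'v \<Rightarrow> real" where
  "total_variation E x = (\<Sum>(i, j) | {i, j} \<in> E. \<bar>x $ i - x $ j\<bar>) / 2"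

definition weighted_sphere :: "'v::finite set set \<Rightarrow> (real ^ 'v) set" where
  "weighted_sphere E = {x. (\<Sum>i\<in>UNIV. real (vertex_degree E i) * \<bar>x $ i\<bar>) = 1}"

text \<open>\<open>Euclidean_space m\<close> consists of the sequences \<open>nat \<Rightarrow> real\<close> vanishing from index \<open>m\<close> on.
  The genus is only applied to sets not containing the origin; for these the inclusion map shows
  that the set of admissible \<open>m\<close> is nonempty.\<close>

definition genus :: "(real ^ 'v::finite) set \<Rightarrow> nat" where
  "genus A = (LEAST m. \<exists>f.
     continuous_map (top_of_set A)
       (subtopology (Euclidean_space m) (- {\<lambda>_. 0})) f \<and>
     (\<forall>x\<in>A. f (- x) = (\<lambda>i. - f x i)))"

text \<open>The sets \<open>A\<close> below are compact if the graph has no isolated vertex, and nonempty if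
  \<open>k \<ge> 1\<close>; the inner supremum is then a maximum.\<close>

definition minimax :: "'v::finite set set \<Rightarrow> nat \<Rightarrow> real" where
  "minimax E k =
     (INF A \<in> {A. A \<subseteq> weighted_sphere E \<and> closed A \<and> uminus ` A = A \<and> genus A \<ge> k}.
        SUP x\<in>A. total_variation E x)"

text \<open>The numeral type \<open>6\<close> has the six elements \<open>1, \<dots>, 6\<close>, where \<open>6 = 0\<close>.\<close>

definition G6 :: "6 set set" where
  "G6 = {{1,2}, {1,3}, {1,4}, {1,5}, {1,6}, {2,3}, {2,4}, {2,5}, {3,4}, {5,6}}"

lemma UNIV_6: "(UNIV :: 6 set) = {1, 2, 3, 4, 5, 6}"
proof -
  have "card {1, 2, 3, 4, 5, 6 :: 6} = CARD(6)"
    by simp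
  then have "{1, 2, 3, 4, 5, 6 :: 6} = UNIV"
    by (intro card_subset_eq) auto
  then show ?thesis ..
qed

lemma simple_graph_G6: "simple_graph G6"
  by (simp add: simple_graph_def G6_def)

lemma connected_graph_G6: "connected_graph G6"
proof -
  let ?R = "{(u, v). {u, v} \<in> G6}"
  have from1: "(1, i) \<in> ?R\<^sup>*" for i
  proof (cases "i = 1")
    case False
    have "i \<in> {1, 2, 3, 4, 5, 6}"
      using UNIV_6 by blast
    with False have "{1, i} \<in> G6"
      unfolding G6_def by (elim insertE) simp_all
    then show ?thesis by (intro r_into_rtrancl) simp
  qed simp
  have "sym ?R"
    by (auto simp: sym_def insert_commute)
  then have "sym (?R\<^sup>*)"
    by (rule sym_rtrancl)
  then show ?thesis
    unfolding connected_graph_def using from1 by (blast intro: rtrancl_trans dest: symD)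
qed

end

theory Submission
  imports Defs
begin

text \<open>If \<open>x\<close> is an eigenvector with a positive entry, then the indicator vector of
  \<open>S = {i. x $ i > 0}\<close> is an eigenvector for the same eigenvalue and the same \<open>z\<close>. Summing the
  equations over \<open>S\<close> gives \<open>\<mu> = cut S / vol S\<close>, and summing them over all vertices gives
  \<open>\<mu> * vol S \<le> \<mu> * vol (- S)\<close>. For \<open>G6\<close> the quotients \<open>cut S / vol S\<close> with
  \<open>vol S \<le> vol (- S)\<close> are exactly the nonzero values in the list, and for each of them a suitable
  \<open>S\<close> admits a \<open>z\<close>. The minimax values are at most six in number, so they cannot exhaust nine eigenvalues.\<close>

section \<open>Reduction to indicator vectors of vertex sets\<close>

definition edge_condition :: "'v set \<Rightarrow> 'v \<Rightarrow> 'v \<Rightarrow> real \<Rightarrow> bool" where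
  "edge_condition S i j w \<longleftrightarrow>
     -1 \<le> w \<and> w \<le> 1 \<and> (i \<in> S \<and> j \<notin> S \<longrightarrow> w = 1) \<and> (i \<notin> S \<and> j \<in> S \<longrightarrow> w = -1)"

lemma edge_condition_uminus: "edge_condition S j i (- w) \<longleftrightarrow> edge_condition S i j w"
  by (auto simp: edge_condition_def)

text \<open>Together with \<open>edge_condition\<close> this spells out the eigenvalue equations for
  the indicator vector of \<open>S\<close>, with \<open>c\<close> standing for \<mu> times the
  degree. The absolute value is there because the sign of \<mu> is not yet known.\<close>

definition vertex_condition :: "'v set \<Rightarrow> real \<Rightarrow> 'v \<Rightarrow> real \<Rightarrow> bool" where
  "vertex_condition S c i s \<longleftrightarrow> (if i \<in> S then s = c else - \<bar>c\<bar> \<le> s \<and> s \<le> \<bar>c\<bar>)"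

lemma Sgn_bounds:
  assumes "t \<in> Sgn u"
  shows "-1 \<le> t" "t \<le> 1" "\<bar>t\<bar> \<le> 1"
  using assms by (auto simp: Sgn_def split: if_splits)

lemma minus_le_and_le_iff_abs_le: "- c \<le> s \<and> s \<le> c \<longleftrightarrow> \<bar>s\<bar> \<le> (c::real)"
  by auto

lemma uminus_Sgn: "t \<in> Sgn u \<Longrightarrow> - t \<in> Sgn (- u)"
  by (auto simp: Sgn_def split: if_splits)

lemma mult_Sgn_0: "(\<lambda>t. c * t) ` Sgn 0 = {s. \<bar>s\<bar> \<le> \<bar>c\<bar>}"
proof (intro equalityI subsetI)
  fix s assume "s \<in> (\<lambda>t. c * t) ` Sgn 0"
  then show "s \<in> {s. \<bar>s\<bar> \<le> \<bar>c\<bar>}"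
    by (auto simp: abs_mult simp del: mult_le_cancel_left1 mult_le_cancel_left2
        dest!: Sgn_bounds(3) intro!: mult_left_le)
next
  fix s assume "s \<in> {s. \<bar>s\<bar> \<le> \<bar>c\<bar>}"
  \<comment> \<open>For \<open>c = 0\<close> also \<open>s = 0\<close>, and division by zero yields
    0, so the equation still holds.\<close>
  then have "s = c * (s / c)" "s / c \<in> Sgn 0"
    by (auto simp: Sgn_def abs_le_iff[symmetric] divide_simps split: if_splits)
  then show "s \<in> (\<lambda>t. c * t) ` Sgn 0" by blast
qed

text \<open>Negating \<open>x\<close> and \<open>z\<close> together preserves the equations, since
  \<open>Sgn (- t)\<close> is the negative of \<open>Sgn t\<close>. A positive entry makes the set
  of positive vertices nonempty.\<close>

lemma one_laplacian_eigenvalue_positive_entry: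
  assumes "one_laplacian_eigenvalue E \<mu>"
  obtains x :: "real ^ 'v::finite" and i z where "x $ i > 0"
    and "\<And>i j. {i, j} \<in> E \<Longrightarrow> z i j \<in> Sgn (x $ i - x $ j) \<and> z j i = - z i j"
    and "\<And>i. (\<Sum>j | {i, j} \<in> E. z i j) \<in> (\<lambda>s. \<mu> * real (vertex_degree E i) * s) ` Sgn (x $ i)"
proof -
  from assms obtain x :: "real ^ 'v" and z where "x \<noteq> 0"
    and z: "\<And>i j. {i, j} \<in> E \<Longrightarrow> z i j \<in> Sgn (x $ i - x $ j) \<and> z j i = - z i j"
    and s: "\<And>i. (\<Sum>j | {i, j} \<in> E. z i j)
              \<in> (\<lambda>s. \<mu> * real (vertex_degree E i) * s) ` Sgn (x $ i)"
    unfolding one_laplacian_eigenvalue_def by blast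
  from \<open>x \<noteq> 0\<close> obtain i where "x $ i \<noteq> 0"
    by (auto simp: vec_eq_iff)
  then consider "x $ i > 0" | "(- x) $ i > 0"
    by fastforce
  then show thesis
  proof cases
    case 1
    then show thesis using that z s by blast
  next
    case 2
    show thesis
    proof (rule that[OF 2])
      fix i j assume "{i, j} \<in> E"
      then show "- z i j \<in> Sgn ((- x) $ i - (- x) $ j) \<and> - z j i = - (- z i j)"
        using z[of i j] uminus_Sgn[of "z i j" "x $ i - x $ j"] by simp
    next
      fix i
      obtain t where "t \<in> Sgn (x $ i)"
        "(\<Sum>j | {i, j} \<in> E. z i j) = \<mu> * real (vertex_degree E i) * t"
        using s by blast
      then show "(\<Sum>j | {i, j} \<in> E. - z i j)
          \<in> (\<lambda>s. \<mu> * real (vertex_degree E i) * s) ` Sgn ((- x) $ i)"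
        by (intro image_eqI[of _ _ "- t"]) (auto simp: sum_negf dest: uminus_Sgn)
    qed
  qed
qed

text \<open>Passing from \<open>x\<close> to the indicator of its positive entries may turn a strict
  inequality between entries into an equality but never reverses one, and negative entries become 0.
  Hence every \<open>Sgn\<close> in the equations can only grow, and the old \<open>z\<close> stays
  admissible. Conversely, the indicator of \<open>S\<close> is itself an eigenvector.\<close>

lemma one_laplacian_eigenvalue_iff_vertex_set:
  fixes E :: "'v::finite set set"
  shows "one_laplacian_eigenvalue E \<mu> \<longleftrightarrow>
    (\<exists>S z. S \<noteq> {} \<and> (\<forall>i j. {i, j} \<in> E \<longrightarrow> edge_condition S i j (z i j) \<and> z j i = - z i j) \<and>
       (\<forall>i. vertex_condition S (\<mu> * real (vertex_degree E i)) i (\<Sum>j | {i, j} \<in> E. z i j)))"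
    (is "_ \<longleftrightarrow> ?rhs")
proof
  assume "one_laplacian_eigenvalue E \<mu>"
  then obtain x :: "real ^ 'v" and i z where "x $ i > 0"
    and z: "\<And>i j. {i, j} \<in> E \<Longrightarrow> z i j \<in> Sgn (x $ i - x $ j) \<and> z j i = - z i j"
    and s: "\<And>i. (\<Sum>j | {i, j} \<in> E. z i j)
              \<in> (\<lambda>s. \<mu> * real (vertex_degree E i) * s) ` Sgn (x $ i)"
    using one_laplacian_eigenvalue_positive_entry by blast
  define S where "S = {i. x $ i > 0}"
  have "S \<noteq> {}"
    using \<open>x $ i > 0\<close> by (auto simp: S_def)
  moreover have "edge_condition S i j (z i j) \<and> z j i = - z i j" if "{i, j} \<in> E" for i j
    using z[OF that] Sgn_bounds(1,2)[of "z i j" "x $ i - x $ j"]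
    by (auto simp: edge_condition_def S_def Sgn_def split: if_splits)
  moreover have "vertex_condition S (\<mu> * real (vertex_degree E i)) i (\<Sum>j | {i, j} \<in> E. z i j)" for i
  proof -
    obtain t where t: "t \<in> Sgn (x $ i)"
      "(\<Sum>j | {i, j} \<in> E. z i j) = \<mu> * real (vertex_degree E i) * t"
      using s by blast
    show ?thesis
      using t(1) Sgn_bounds(3)[OF t(1)] unfolding vertex_condition_def t(2) minus_le_and_le_iff_abs_le
      by (auto simp: S_def Sgn_def abs_mult intro!: mult_left_le)
  qed
  ultimately show ?rhs by blast
next
  assume ?rhs
  then obtain S z where "S \<noteq> {}"
    and z: "\<And>i j. {i, j} \<in> E \<Longrightarrow> edge_condition S i j (z i j) \<and> z j i = - z i j"
    and s: "\<And>i. vertex_condition S (\<mu> * real (vertex_degree E i)) i (\<Sum>j | {i, j} \<in> E. z i j)"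
    by blast
  define x :: "real ^ 'v" where "x = (\<chi> i. if i \<in> S then 1 else 0)"
  have "x \<noteq> 0"
    using \<open>S \<noteq> {}\<close> by (auto simp: x_def vec_eq_iff)
  moreover have "z i j \<in> Sgn (x $ i - x $ j) \<and> z j i = - z i j" if "{i, j} \<in> E" for i j
    using z[OF that] by (auto simp: edge_condition_def x_def Sgn_def)
  moreover have "(\<Sum>j | {i, j} \<in> E. z i j)
      \<in> (\<lambda>s. \<mu> * real (vertex_degree E i) * s) ` Sgn (x $ i)" for i
  proof (cases "i \<in> S")
    case True
    then show ?thesis
      using s[of i] by (simp add: vertex_condition_def x_def Sgn_def)
  next
    case False
    then have "x $ i = 0" by (simp add: x_def)
    then show ?thesis
      using s[of i] False by (simp only: mult_Sgn_0) (simp add: vertex_condition_def abs_le_iff)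
  qed
  ultimately show "one_laplacian_eigenvalue E \<mu>"
    unfolding one_laplacian_eigenvalue_def by blast
qed

section \<open>The equations for \<open>G6\<close> in coordinates\<close>

lemma neighbours_G6:
  "{j. {1, j} \<in> G6} = {2, 3, 4, 5, 6}"
  "{j. {2, j} \<in> G6} = {1, 3, 4, 5}"
  "{j. {3, j} \<in> G6} = {1, 2, 4}"
  "{j. {4, j} \<in> G6} = {1, 2, 3}"
  "{j. {5, j} \<in> G6} = {1, 2, 6}"
  "{j. {6, j} \<in> G6} = {1, 5}"
  unfolding G6_def by (auto simp: doubleton_eq_iff)

lemma all_6_iff: "(\<forall>i::6. P i) \<longleftrightarrow> P 1 \<and> P 2 \<and> P 3 \<and> P 4 \<and> P 5 \<and> P 6"
proof -
  have "(\<forall>i. P i) \<longleftrightarrow> (\<forall>i\<in>{1, 2, 3, 4, 5, 6}. P i)"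
    by (simp flip: UNIV_6)
  then show ?thesis by simp
qed

lemma all_adjacent_G6_iff:
  "(\<forall>i j. {i, j} \<in> G6 \<longrightarrow> P i j) \<longleftrightarrow>
     (\<forall>j\<in>{2, 3, 4, 5, 6}. P 1 j) \<and> (\<forall>j\<in>{1, 3, 4, 5}. P 2 j) \<and> (\<forall>j\<in>{1, 2, 4}. P 3 j) \<and>
     (\<forall>j\<in>{1, 2, 3}. P 4 j) \<and> (\<forall>j\<in>{1, 2, 6}. P 5 j) \<and> (\<forall>j\<in>{1, 5}. P 6 j)"
  unfolding neighbours_G6[symmetric] all_6_iff[of "\<lambda>i. \<forall>j. {i, j} \<in> G6 \<longrightarrow> P i j"]
  by (simp only: mem_Collect_eq Ball_def)

text \<open>One unknown per edge, oriented from the smaller to the larger label, builds in the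
  antisymmetry of \<open>z\<close>. The factors 5, 4, 3, 3, 3, 2 are the degrees.\<close>

definition G6_system where
  "G6_system S \<mu> z12 z13 z14 z15 z16 z23 z24 z25 z34 z56 \<longleftrightarrow>
     edge_condition S 1 2 z12 \<and> edge_condition S 1 3 z13 \<and> edge_condition S 1 4 z14 \<and>
     edge_condition S 1 5 z15 \<and> edge_condition S 1 6 z16 \<and> edge_condition S 2 3 z23 \<and>
     edge_condition S 2 4 z24 \<and> edge_condition S 2 5 z25 \<and> edge_condition S 3 4 z34 \<and>
     edge_condition S 5 (6::6) z56 \<and>
     vertex_condition S (\<mu> * 5) 1 (z12 + z13 + z14 + z15 + z16) \<and>
     vertex_condition S (\<mu> * 4) 2 (- z12 + z23 + z24 + z25) \<and>
     vertex_condition S (\<mu> * 3) 3 (- z13 - z23 + z34) \<and>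
     vertex_condition S (\<mu> * 3) 4 (- z14 - z24 - z34) \<and>
     vertex_condition S (\<mu> * 3) 5 (- z15 - z25 + z56) \<and>
     vertex_condition S (\<mu> * 2) 6 (- z16 - z56)"

lemma eigenvalue_G6_imp_system:
  assumes "one_laplacian_eigenvalue G6 \<mu>"
  obtains S z12 z13 z14 z15 z16 z23 z24 z25 z34 z56 where "S \<noteq> {}"
    and "G6_system S \<mu> z12 z13 z14 z15 z16 z23 z24 z25 z34 z56"
proof -
  from assms obtain S z where "S \<noteq> {}"
    and z: "\<And>i j. {i, j} \<in> G6 \<Longrightarrow> edge_condition S i j (z i j) \<and> z j i = - z i j"
    and s: "\<And>i. vertex_condition S (\<mu> * real (vertex_degree G6 i)) i (\<Sum>j | {i, j} \<in> G6. z i j)"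
    unfolding one_laplacian_eigenvalue_iff_vertex_set by blast
  have e: "edge_condition S 1 2 (z 1 2) \<and> z 2 1 = - z 1 2"
    "edge_condition S 1 3 (z 1 3) \<and> z 3 1 = - z 1 3"
    "edge_condition S 1 4 (z 1 4) \<and> z 4 1 = - z 1 4"
    "edge_condition S 1 5 (z 1 5) \<and> z 5 1 = - z 1 5"
    "edge_condition S 1 6 (z 1 6) \<and> z 6 1 = - z 1 6"
    "edge_condition S 2 3 (z 2 3) \<and> z 3 2 = - z 2 3"
    "edge_condition S 2 4 (z 2 4) \<and> z 4 2 = - z 2 4"
    "edge_condition S 2 5 (z 2 5) \<and> z 5 2 = - z 2 5"
    "edge_condition S 3 4 (z 3 4) \<and> z 4 3 = - z 3 4"
    "edge_condition S 5 6 (z 5 6) \<and> z 6 5 = - z 5 6"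
    by (rule z, simp add: G6_def)+
  have "G6_system S \<mu> (z 1 2) (z 1 3) (z 1 4) (z 1 5) (z 1 6) (z 2 3) (z 2 4) (z 2 5) (z 3 4) (z 5 6)"
    using e s[of 1] s[of 2] s[of 3] s[of 4] s[of 5] s[of 6]
    by (simp add: G6_system_def vertex_degree_def neighbours_G6 algebra_simps)
  with \<open>S \<noteq> {}\<close> show thesis by (rule that)
qed

lemma system_imp_eigenvalue_G6:
  assumes "S \<noteq> {}" and sys: "G6_system S \<mu> z12 z13 z14 z15 z16 z23 z24 z25 z34 z56"
  shows "one_laplacian_eigenvalue G6 \<mu>"
proof -
  \<comment> \<open>\<open>w\<close> holds the given values above the diagonal; antisymmetrizing it
    gives \<open>z\<close>.\<close>
  define w :: "6 \<Rightarrow> 6 \<Rightarrow> real" where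
    "w = (\<lambda>_ _. 0)(1 := (\<lambda>_. 0)(2 := z12, 3 := z13, 4 := z14, 5 := z15, 6 := z16),
       2 := (\<lambda>_. 0)(3 := z23, 4 := z24, 5 := z25), 3 := (\<lambda>_. 0)(4 := z34),
       5 := (\<lambda>_. 0)(6 := z56))"
  define z where "z i j = w i j - w j i" for i j
  have "\<forall>i j. {i, j} \<in> G6 \<longrightarrow> edge_condition S i j (z i j)"
    using sys unfolding all_adjacent_G6_iff
    by (simp add: z_def w_def G6_system_def edge_condition_uminus)
  moreover have "z j i = - z i j" for i j
    by (simp add: z_def)
  moreover have "\<forall>i. vertex_condition S (\<mu> * real (vertex_degree G6 i)) i (\<Sum>j | {i, j} \<in> G6. z i j)"
    using sys unfolding all_6_iff
    by (simp add: G6_system_def vertex_degree_def neighbours_G6 z_def w_def algebra_simps)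
  ultimately show ?thesis
    unfolding one_laplacian_eigenvalue_iff_vertex_set using \<open>S \<noteq> {}\<close> by blast
qed

section \<open>Explicit solutions for the nine values\<close>

lemma eigenvalue_G6_witnesses:
  assumes "\<mu> \<in> {0, 2/5, 5/9, 3/5, 2/3, 5/7, 3/4, 7/9, 1}"
  shows "one_laplacian_eigenvalue G6 \<mu>"
proof -
  \<comment> \<open>In each row \<mu> is cut / vol of the set, and edges leaving the set carry
    forced values 1 or -1. The other entries balance the vertices inside and keep the sums outside
    within bounds. The set \<open>{2, 3, 4}\<close> has volume 10, half of the total, so there the
    outer sums must all equal minus \<mu> times the degree.\<close>
  have "G6_system {1, 2, 3, 4, 5, 6} 0 0 0 0 0 0 0 0 0 0 0"
    "G6_system {2, 3, 4} (2/5) (-1) (-1) (-1) 0 1 0 (-2/5) 1 (1/5) (-1/5)"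
    "G6_system {2, 5, 6} (5/9) (-1) 0 (2/9) (-1) (-1) 1 1 (-7/9) 0 (-1/9)"
    "G6_system {5, 6} (3/5) 0 0 0 (-1) (-1) 0 0 (-1) 0 (-1/5)"
    "G6_system {3, 4} (2/3) 0 (-1) (-1) 0 0 (-1) (-1) 0 0 0"
    "G6_system {1, 6} (5/7) 1 1 1 1 (-3/7) 0 0 0 0 (-1)"
    "G6_system {1, 3} (3/4) 1 (-1/4) 1 1 1 (-1) 0 0 1 0"
    "G6_system {1, 2} (7/9) (-1/9) 1 1 1 1 1 1 1 0 0"
    "G6_system {6} 1 0 0 0 0 (-1) 0 0 0 0 (-1)"
    by (simp_all add: G6_system_def edge_condition_def vertex_condition_def)
  note this[THEN system_imp_eigenvalue_G6[OF insert_not_empty]]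
  with assms show ?thesis by blast
qed

section \<open>Exclusion of all other values\<close>

lemma eigenvalue_G6_cases:
  assumes "one_laplacian_eigenvalue G6 \<mu>"
  shows "\<mu> \<in> {0, 2/5, 5/9, 3/5, 2/3, 5/7, 3/4, 7/9, 1}"
proof -
  obtain S z12 z13 z14 z15 z16 z23 z24 z25 z34 z56 where "S \<noteq> {}"
    and sys: "G6_system S \<mu> z12 z13 z14 z15 z16 z23 z24 z25 z34 z56"
    using assms by (rule eigenvalue_G6_imp_system)
  \<comment> \<open>A real-valued indicator turns sums over the unknown set \<open>S\<close> into
    fixed linear expressions.\<close>
  define a where "a i = (if i \<in> S then 1 else 0 :: real)" for i
  define vol where "vol = 5 * a 1 + 4 * a 2 + 3 * a 3 + 3 * a 4 + 3 * a 5 + 2 * a 6"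
  define cut where "cut = \<bar>a 1 - a 2\<bar> + \<bar>a 1 - a 3\<bar> + \<bar>a 1 - a 4\<bar> + \<bar>a 1 - a 5\<bar> + \<bar>a 1 - a 6\<bar>
    + \<bar>a 2 - a 3\<bar> + \<bar>a 2 - a 4\<bar> + \<bar>a 2 - a 5\<bar> + \<bar>a 3 - a 4\<bar> + \<bar>a 5 - a 6\<bar>"
  have "\<exists>i. i \<in> S" using \<open>S \<noteq> {}\<close> by blast
  then have ne: "1 \<in> S \<or> 2 \<in> S \<or> 3 \<in> S \<or> 4 \<in> S \<or> 5 \<in> S \<or> 6 \<in> S"
    using all_6_iff[of "\<lambda>i. i \<notin> S"] by blast
  have "\<mu> * vol = a 1 * (\<mu> * 5) + a 2 * (\<mu> * 4) + a 3 * (\<mu> * 3) + a 4 * (\<mu> * 3)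
      + a 5 * (\<mu> * 3) + a 6 * (\<mu> * 2)"
    by (simp add: vol_def algebra_simps)
  also have "\<dots> = a 1 * (z12 + z13 + z14 + z15 + z16) + a 2 * (- z12 + z23 + z24 + z25)
      + a 3 * (- z13 - z23 + z34) + a 4 * (- z14 - z24 - z34) + a 5 * (- z15 - z25 + z56)
      + a 6 * (- z16 - z56)"
    using sys by (simp add: G6_system_def vertex_condition_def a_def)
  also have "\<dots> = (a 1 - a 2) * z12 + (a 1 - a 3) * z13 + (a 1 - a 4) * z14 + (a 1 - a 5) * z15
      + (a 1 - a 6) * z16 + (a 2 - a 3) * z23 + (a 2 - a 4) * z24 + (a 2 - a 5) * z25
      + (a 3 - a 4) * z34 + (a 5 - a 6) * z56"
    \<comment> \<open>Summation by parts: each edge variable enters at its two endpoints with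
      opposite signs.\<close>
    by (simp add: algebra_simps)
  also have "\<dots> = cut"
  proof -
    \<comment> \<open>The coefficient vanishes unless the edge crosses the boundary of
      \<open>S\<close>, and then \<open>w\<close> is forced to be its sign.\<close>
    have edge: "(a i - a j) * w = \<bar>a i - a j\<bar>" if "edge_condition S i j w" for i j w
      using that by (auto simp: edge_condition_def a_def)
    show ?thesis
      using sys by (simp add: G6_system_def edge cut_def)
  qed
  finally have "\<mu> * vol = cut" .
  moreover have "vol > 0"
    using ne by (auto simp: vol_def a_def)
  ultimately have mu: "\<mu> = cut / vol"
    by (simp add: field_simps)
  have "\<mu> \<ge> 0"
    unfolding mu using \<open>vol > 0\<close> by (simp add: cut_def)
  \<comment> \<open>The factor \<open>2 * a i - 1\<close> is 1 on \<open>S\<close> and -1 outside,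
    and \<open>\<mu> \<ge> 0\<close> resolves the absolute value in the lower bound.\<close>
  have vertex: "\<mu> * d * (2 * a i - 1) \<le> s"
    if "vertex_condition S (\<mu> * d) i s" "d \<ge> 0" for d i s
    using that \<open>\<mu> \<ge> 0\<close> by (auto simp: vertex_condition_def a_def)
  have "\<mu> * 5 * (2 * a 1 - 1) \<le> z12 + z13 + z14 + z15 + z16"
    "\<mu> * 4 * (2 * a 2 - 1) \<le> - z12 + z23 + z24 + z25"
    "\<mu> * 3 * (2 * a 3 - 1) \<le> - z13 - z23 + z34"
    "\<mu> * 3 * (2 * a 4 - 1) \<le> - z14 - z24 - z34"
    "\<mu> * 3 * (2 * a 5 - 1) \<le> - z15 - z25 + z56"
    "\<mu> * 2 * (2 * a 6 - 1) \<le> - z16 - z56"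
    using sys unfolding G6_system_def by (intro vertex; simp)+
  \<comment> \<open>Adding the six inequalities cancels every edge variable. The degrees sum to 20,
    so half of the result is this bound.\<close>
  then have "\<mu> * (vol - 10) \<le> 0"
    by (simp add: vol_def algebra_simps)
  then consider "\<mu> = 0" | "vol \<le> 10"
    using \<open>\<mu> \<ge> 0\<close> by (auto simp: mult_le_0_iff)
  then show ?thesis
  proof cases
    case 2
    with ne show ?thesis
      unfolding mu
      \<comment> \<open>For each of the 64 subsets, \<open>ne\<close> fails, or
        \<open>vol \<le> 10\<close> fails, or the quotient is a listed value.\<close>
      by (cases "1 \<in> S"; cases "2 \<in> S"; cases "3 \<in> S"; cases "4 \<in> S"; cases "5 \<in> S"; cases "6 \<in> S";
          simp add: cut_def vol_def a_def)
  qed simp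
qed

theorem mainTheorem10:
  shows "{\<mu>. one_laplacian_eigenvalue G6 \<mu>}
           = {0, 2/5, 5/9, 3/5, 2/3, 5/7, 3/4, 7/9, 1} \<and>
         (\<exists>\<mu>. one_laplacian_eigenvalue G6 \<mu> \<and> \<mu> \<notin> minimax G6 ` {1..6})"
proof
  show spectrum: "{\<mu>. one_laplacian_eigenvalue G6 \<mu>}
      = {0, 2/5, 5/9, 3/5, 2/3, 5/7, 3/4, 7/9, 1}"
    using eigenvalue_G6_witnesses eigenvalue_G6_cases by blast
  have "\<not> {\<mu>. one_laplacian_eigenvalue G6 \<mu>} \<subseteq> minimax G6 ` {1..6}"
  proof
    assume "{\<mu>. one_laplacian_eigenvalue G6 \<mu>} \<subseteq> minimax G6 ` {1..6}"
    then have "card {\<mu>. one_laplacian_eigenvalue G6 \<mu>} \<le> card {1..6::nat}"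
      by (rule surj_card_le[rotated]) simp
    \<comment> \<open>The nine listed fractions are pairwise distinct, so the inequality would read
      9 \<le> 6.\<close>
    then show False
      unfolding spectrum by simp
  qed
  then show "\<exists>\<mu>. one_laplacian_eigenvalue G6 \<mu> \<and> \<mu> \<notin> minimax G6 ` {1..6}"
    by blast
qed

end
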